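(* Let $n\ge 1$ be an integer and let $\mathcal{M}_n:=\{M\in\mathbb{R}^{n\times n}\mid M=M^{\prime}\geq 0\}$ be the cone of real symmetric non-negative definite $n\times n$ matrices. For $M_1,M_2\in\mathcal{M}_n$ let $$\tau(M_1,M_2):=\min\left\{\tfrac{1}{n}\operatorname{trace}(M)\;\middle|\; M\in\mathcal{M}_n,\ M\geq M_1\text{ and }M\geq M_2\right\}.$$ Then $$\delta(M_1,M_2):=2\tau(M_1,M_2)-\tfrac1n\operatorname{trace}(M_1)-\tfrac1n\operatorname{trace}(M_2)$$ defines a metric on $\mathcal{M}_n$.
   Context: $M^{\prime}$ denotes the transpose of $M$. For real symmetric matrices $A,B$, $A\geq B$ means that $A-B$ is non-negative definite (positive semidefinite). *)

theory Defs
  imports "HOL-Analysis.Analysis"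
begin

definition nonneg_definite :: "real^'n^'n \<Rightarrow> bool" where
  "nonneg_definite A \<longleftrightarrow> (\<forall>x. 0 \<le> x \<bullet> (A *v x))"

(* Only used between symmetric matrices; nonneg_definite itself does not impose symmetry. *)
definition loewner_ge :: "real^'n^'n \<Rightarrow> real^'n^'n \<Rightarrow> bool" (infix "\<ge>\<^sub>L" 50) where
  "A \<ge>\<^sub>L B \<longleftrightarrow> nonneg_definite (A - B)"

definition nnd_cone :: "(real^'n^'n) set" where
  "nnd_cone = {M. M = transpose M \<and> M \<ge>\<^sub>L 0}"

definition majorant_traces :: "real^'n^'n \<Rightarrow> real^'n^'n \<Rightarrow> real set" where
  "majorant_traces M\<^sub>1 M\<^sub>2 =
     {1 / real CARD('n) * trace M | M. M \<in> nnd_cone \<and> M \<ge>\<^sub>L M\<^sub>1 \<and> M \<ge>\<^sub>L M\<^sub>2}"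

(* An attained minimum: LEAST is unspecified if the set has no least element,
   in particular it does not fall back to the infimum. *)
definition tau :: "real^'n^'n \<Rightarrow> real^'n^'n \<Rightarrow> real" where
  "tau M\<^sub>1 M\<^sub>2 = (LEAST t. t \<in> majorant_traces M\<^sub>1 M\<^sub>2)"

definition delta :: "real^'n^'n \<Rightarrow> real^'n^'n \<Rightarrow> real" where
  "delta M\<^sub>1 M\<^sub>2 =
     2 * tau M\<^sub>1 M\<^sub>2 - 1 / real CARD('n) * trace M\<^sub>1 - 1 / real CARD('n) * trace M\<^sub>2"

(* The locale Metric_space requires nonnegativity and symmetry of the distance on the
   whole type, also outside the carrier; delta is meaningful only on the cone and is
   therefore extended by the irrelevant value 0. *)
definition delta_on_cone :: "real^'n^'n \<Rightarrow> real^'n^'n \<Rightarrow> real" where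
  "delta_on_cone M\<^sub>1 M\<^sub>2 = (if M\<^sub>1 \<in> nnd_cone \<and> M\<^sub>2 \<in> nnd_cone then delta M\<^sub>1 M\<^sub>2 else 0)"

end

theory Submission
  imports Defs
begin

text \<open>A non-negative definite matrix has all its entries bounded by its trace. Hence the
  majorants of bounded trace form a compact set, so that the minimum is attained, and
  \<open>\<delta>(M\<^sub>1, M\<^sub>2) = 0\<close> forces the optimal majorant to equal both arguments. For the triangle
  inequality, if \<open>M\<close> majorizes \<open>M\<^sub>1, M\<^sub>2\<close> and \<open>N\<close> majorizes \<open>M\<^sub>2, M\<^sub>3\<close>, then
  \<open>M + N - M\<^sub>2\<close> majorizes \<open>M\<^sub>1, M\<^sub>3\<close>.\<close>

text \<open>For fixed \<open>x\<close> and \<open>y\<close> this exhibits the form as linear in the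
  entries of \<open>A\<close>, the shape in which its continuity in \<open>A\<close> is
  evident.\<close>

lemma inner_matrix_vector_mult:
  fixes A :: "real^'n^'n"
  shows "x \<bullet> (A *v y) = (\<Sum>i\<in>UNIV. \<Sum>j\<in>UNIV. A $ i $ j * (x $ i * y $ j))"
  by (simp add: inner_vec_def matrix_vector_mult_def sum_distrib_left mult_ac)

lemma inner_axis_matrix_axis:
  fixes A :: "real^'n^'n"
  shows "axis i 1 \<bullet> (A *v axis j 1) = A $ i $ j"
  by (simp add: inner_axis' matrix_vector_mult_basis column_def)

lemma nonneg_definite_0: "nonneg_definite 0"
  by (simp add: nonneg_definite_def)

lemma nonneg_definite_add:
  "nonneg_definite A \<Longrightarrow> nonneg_definite B \<Longrightarrow> nonneg_definite (A + B)"
  by (simp add: nonneg_definite_def matrix_vector_mult_add_rdistrib inner_add_right)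

lemma nonneg_definite_diag: "nonneg_definite A \<Longrightarrow> 0 \<le> A $ i $ i"
  by (metis inner_axis_matrix_axis nonneg_definite_def)

lemma nonneg_definite_diag_le_trace: "nonneg_definite A \<Longrightarrow> A $ i $ i \<le> trace A"
  unfolding trace_def by (rule member_le_sum) (auto simp: nonneg_definite_diag)

lemma nonneg_definite_trace: "nonneg_definite A \<Longrightarrow> 0 \<le> trace A"
  unfolding trace_def by (simp add: sum_nonneg nonneg_definite_diag)

text \<open>Testing the form on the sum and the difference of two basis vectors bounds twice the
  off-diagonal entry, in absolute value, by the two diagonal entries; symmetry merges the cross
  terms. Each diagonal entry is at most the trace.\<close>

lemma nonneg_definite_entry_le_trace:
  fixes A :: "real^'n^'n"
  assumes "nonneg_definite A" "transpose A = A"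
  shows "\<bar>A $ i $ j\<bar> \<le> trace A"
proof -
  have sym: "A $ j $ i = A $ i $ j"
    using assms(2) by (metis transpose_def vec_lambda_beta)
  have "0 \<le> (axis i 1 + axis j 1) \<bullet> (A *v (axis i 1 + axis j 1))"
    "0 \<le> (axis i 1 - axis j 1) \<bullet> (A *v (axis i 1 - axis j 1))"
    using assms(1) unfolding nonneg_definite_def by blast+
  then have "0 \<le> A $ i $ i + A $ j $ j + 2 * A $ i $ j" "0 \<le> A $ i $ i + A $ j $ j - 2 * A $ i $ j"
    by (simp_all add: matrix_vector_right_distrib matrix_vector_mult_diff_distrib
        inner_add_left inner_add_right inner_diff_left inner_diff_right inner_axis_matrix_axis sym)
  with nonneg_definite_diag_le_trace[OF assms(1), of i] nonneg_definite_diag_le_trace[OF assms(1), of j]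
  show ?thesis by linarith
qed

text \<open>Symmetry matters: a skew-symmetric matrix also satisfies \<open>nonneg_definite\<close>
  and has trace 0.\<close>

lemma nonneg_definite_trace_0_imp_0:
  fixes A :: "real^'n^'n"
  assumes "nonneg_definite A" "transpose A = A" "trace A = 0"
  shows "A = 0"
  using nonneg_definite_entry_le_trace[OF assms(1,2)] assms(3) by (simp add: vec_eq_iff)

text \<open>Each test vector imposes an affine inequality on the entries of \<open>M\<close>, so the
  set is an intersection of closed sets.\<close>

lemma closed_loewner_ge: "closed {M :: real^'n^'n. M \<ge>\<^sub>L A}"
  unfolding loewner_ge_def nonneg_definite_def inner_matrix_vector_mult
  by (intro closed_Collect_all closed_Collect_le continuous_intros)

lemma transpose_diff: "transpose (A - B) = transpose A - transpose (B :: real^'n^'m)"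
  by (simp add: transpose_def vec_eq_iff)

lemma transpose_add: "transpose (A + B) = transpose A + transpose (B :: real^'n^'m)"
  by (simp add: transpose_def vec_eq_iff)

lemma nnd_cone_iff: "M \<in> nnd_cone \<longleftrightarrow> transpose M = M \<and> nonneg_definite M"
  by (auto simp: nnd_cone_def loewner_ge_def)

lemma closed_nnd_cone: "closed (nnd_cone :: (real^'n^'n) set)"
proof -
  have "closed {M :: real^'n^'n. \<forall>i j. M $ i $ j = M $ j $ i}"
    by (intro closed_Collect_all closed_Collect_eq continuous_intros)
  moreover have eq: "nnd_cone = {M :: real^'n^'n. \<forall>i j. M $ i $ j = M $ j $ i} \<inter> {M. M \<ge>\<^sub>L 0}"
    by (auto simp: nnd_cone_def transpose_def vec_eq_iff)
  ultimately show ?thesis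
    unfolding eq by (intro closed_Int closed_loewner_ge)
qed

lemma continuous_on_trace: "continuous_on S (trace :: real^'n^'n \<Rightarrow> real)"
  unfolding trace_def by (intro continuous_intros)

lemma compact_nnd_cone_trace_le:
  "compact (nnd_cone \<inter> {M :: real^'n^'n. trace M \<le> c})"
proof -
  \<comment> \<open>The entry bound is summed over all positions, as the norm is at most the sum of
    the absolute values of the entries.\<close>
  have "norm M \<le> (\<Sum>i\<in>(UNIV::'n set). \<Sum>j\<in>(UNIV::'n set). c)"
    if "M \<in> nnd_cone" "trace M \<le> c" for M :: "real^'n^'n"
  proof -
    have "norm (M $ i) \<le> (\<Sum>j\<in>(UNIV::'n set). c)" for i
    proof (rule order_trans[OF norm_le_l1_cart sum_mono])
      show "\<bar>M $ i $ j\<bar> \<le> c" for j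
        using nonneg_definite_entry_le_trace[of M i j] that by (simp add: nnd_cone_iff)
    qed
    then have "(\<Sum>i\<in>UNIV. norm (M $ i)) \<le> (\<Sum>i\<in>(UNIV::'n set). \<Sum>j\<in>(UNIV::'n set). c)"
      by (intro sum_mono)
    moreover have "norm M \<le> (\<Sum>i\<in>UNIV. norm (M $ i))"
      unfolding norm_vec_def[of M] by (rule L2_set_le_sum) simp
    ultimately show ?thesis by linarith
  qed
  then have "bounded (nnd_cone \<inter> {M :: real^'n^'n. trace M \<le> c})"
    unfolding bounded_iff by blast
  moreover have "closed {M :: real^'n^'n. trace M \<le> c}"
    by (intro closed_Collect_le continuous_on_trace continuous_intros)
  ultimately show ?thesis
    by (simp add: compact_eq_bounded_closed closed_Int closed_nnd_cone)
qed

text \<open>Keeps the matrices behind the values in \<open>majorant_traces\<close>, so that optimal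
  majorants can be combined.\<close>

definition majorants :: "real^'n^'n \<Rightarrow> real^'n^'n \<Rightarrow> (real^'n^'n) set" where
  "majorants A B = {M \<in> nnd_cone. M \<ge>\<^sub>L A \<and> M \<ge>\<^sub>L B}"

lemma majorant_traces_eq:
  "majorant_traces A B = (\<lambda>M. 1 / real CARD('n) * trace M) ` majorants A (B :: real^'n^'n)"
  by (auto simp: majorant_traces_def majorants_def)

lemma majorants_commute: "majorants A B = majorants B A"
  by (auto simp: majorants_def)

lemma add_in_majorants:
  "A \<in> nnd_cone \<Longrightarrow> B \<in> nnd_cone \<Longrightarrow> A + B \<in> majorants A B"
  by (simp add: majorants_def nnd_cone_iff loewner_ge_def transpose_add nonneg_definite_add)

lemma self_in_majorants: "A \<in> nnd_cone \<Longrightarrow> A \<in> majorants A A"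
  by (simp add: majorants_def loewner_ge_def nonneg_definite_0)

lemma majorants_compose:
  assumes "M \<in> majorants A B" "N \<in> majorants B C" and cone: "A \<in> nnd_cone" "B \<in> nnd_cone"
  shows "M + N - B \<in> majorants A C"
proof -
  have M: "nonneg_definite (M - A)" "nonneg_definite (M - B)" "transpose M = M"
    and N: "nonneg_definite (N - B)" "nonneg_definite (N - C)" "transpose N = N"
    using assms by (auto simp: majorants_def loewner_ge_def nnd_cone_iff)
  \<comment> \<open>The difference splits as \<open>(M - A) + (N - B)\<close>, and the one with
    \<open>C\<close> as \<open>(M - B) + (N - C)\<close>.\<close>
  have A: "nonneg_definite (M + N - B - A)"
    using nonneg_definite_add[OF M(1) N(1)] by (simp add: algebra_simps)
  have "nonneg_definite (M + N - B - C)"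
    using nonneg_definite_add[OF M(2) N(2)] by (simp add: algebra_simps)
  moreover have "nonneg_definite (M + N - B)"
    using nonneg_definite_add[OF A, of A] cone by (simp add: nnd_cone_iff)
  ultimately show ?thesis
    using A M N cone by (simp add: majorants_def loewner_ge_def nnd_cone_iff transpose_add transpose_diff)
qed

lemma majorants_min_trace:
  fixes A B :: "real^'n^'n"
  assumes "A \<in> nnd_cone" "B \<in> nnd_cone"
  obtains M where "M \<in> majorants A B" "\<And>N. N \<in> majorants A B \<Longrightarrow> trace M \<le> trace N"
proof -
  \<comment> \<open>The set of majorants is unbounded; cutting it at the trace of the particular
    majorant \<open>A + B\<close> makes it compact and keeps it nonempty.\<close>
  define K where "K = majorants A B \<inter> {M. trace M \<le> trace (A + B)}"
  have "K = nnd_cone \<inter> {M. trace M \<le> trace (A + B)} \<inter> ({M. M \<ge>\<^sub>L A} \<inter> {M. M \<ge>\<^sub>L B})"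
    by (auto simp: K_def majorants_def)
  then have "compact K"
    by (simp add: compact_Int_closed compact_nnd_cone_trace_le closed_Int closed_loewner_ge)
  moreover have AB: "A + B \<in> K"
    using add_in_majorants[OF assms] by (simp add: K_def)
  ultimately obtain M where M: "M \<in> K" "\<And>N. N \<in> K \<Longrightarrow> trace M \<le> trace N"
    using continuous_attains_inf[OF _ _ continuous_on_trace, of K] by blast
  show thesis
  proof
    show "M \<in> majorants A B" using M(1) by (simp add: K_def)
    show "trace M \<le> trace N" if "N \<in> majorants A B" for N
      \<comment> \<open>A majorant outside \<open>K\<close> has trace above that of
        \<open>A + B\<close>, which is at least that of \<open>M\<close>.\<close>
      using that M(2)[of N] M(2)[OF AB] by (cases "N \<in> K") (auto simp: K_def)
  qed
qed

lemma tau_attained: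
  fixes A B :: "real^'n^'n"
  assumes "A \<in> nnd_cone" "B \<in> nnd_cone"
  obtains M where "M \<in> majorants A B" "tau A B = trace M / real CARD('n)"
    "\<And>N. N \<in> majorants A B \<Longrightarrow> trace M \<le> trace N"
proof -
  obtain M where M: "M \<in> majorants A B" "\<And>N. N \<in> majorants A B \<Longrightarrow> trace M \<le> trace N"
    using majorants_min_trace[OF assms] by blast
  have "tau A B = trace M / real CARD('n)"
    unfolding tau_def majorant_traces_eq
    by (rule Least_equality) (use M in \<open>auto intro: divide_right_mono\<close>)
  with M that show thesis by blast
qed

text \<open>Distributing the two copies of \<open>tau\<close> over \<open>A\<close> and
  \<open>B\<close> writes \<open>delta\<close> as a sum of traces of non-negative definite matrices.
  The last clause lets any majorant serve as an upper bound.\<close>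

lemma delta_attained:
  fixes A B :: "real^'n^'n"
  assumes "A \<in> nnd_cone" "B \<in> nnd_cone"
  obtains M where "M \<in> majorants A B"
    "delta A B = (trace (M - A) + trace (M - B)) / real CARD('n)"
    "\<And>N. N \<in> majorants A B \<Longrightarrow> delta A B \<le> (trace (N - A) + trace (N - B)) / real CARD('n)"
proof -
  obtain M where M: "M \<in> majorants A B" "tau A B = trace M / real CARD('n)"
    "\<And>N. N \<in> majorants A B \<Longrightarrow> trace M \<le> trace N"
    using tau_attained[OF assms] by blast
  have eq: "delta A B = (trace (M - A) + trace (M - B)) / real CARD('n)"
    by (simp add: delta_def M(2) trace_sub field_simps)
  have "delta A B \<le> (trace (N - A) + trace (N - B)) / real CARD('n)" if "N \<in> majorants A B" for N
    unfolding eq using M(3)[OF that] by (intro divide_right_mono) (auto simp: trace_sub)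
  with M(1) eq that show thesis by blast
qed

lemma majorants_trace_diff:
  assumes "M \<in> majorants A B"
  shows "0 \<le> trace (M - A)" "0 \<le> trace (M - B)"
  using assms by (auto simp: majorants_def loewner_ge_def intro: nonneg_definite_trace)

lemma delta_nonneg:
  assumes "A \<in> nnd_cone" "B \<in> nnd_cone"
  shows "0 \<le> delta A B"
proof -
  obtain M where M: "M \<in> majorants A B"
    and eq: "delta A B = (trace (M - A) + trace (M - B)) / real CARD('a)"
    using delta_attained[OF assms] by blast
  show ?thesis
    unfolding eq using majorants_trace_diff[OF M] by simp
qed

text \<open>Both sides apply \<open>LEAST\<close> to the same set, so they agree even where no
  minimum exists.\<close>

lemma delta_commute: "delta A B = delta B A"
  by (simp add: delta_def tau_def majorant_traces_eq majorants_commute[of A B])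

lemma delta_self:
  assumes "A \<in> nnd_cone"
  shows "delta A A = 0"
proof -
  obtain M where "\<And>N. N \<in> majorants A A \<Longrightarrow>
      delta A A \<le> (trace (N - A) + trace (N - A)) / real CARD('a)"
    using delta_attained[OF assms assms] by blast
  from this[OF self_in_majorants[OF assms]] have "delta A A \<le> 0" by (simp add: trace_def)
  with delta_nonneg[OF assms assms] show ?thesis by simp
qed

lemma delta_0_imp_eq:
  assumes "A \<in> nnd_cone" "B \<in> nnd_cone" "delta A B = 0"
  shows "A = B"
proof -
  obtain M where M: "M \<in> majorants A B"
    and eq: "delta A B = (trace (M - A) + trace (M - B)) / real CARD('a)"
    using delta_attained[OF assms(1,2)] by blast
  have "trace (M - A) + trace (M - B) = 0"
    using assms(3) eq by simp
  then have "trace (M - A) = 0" "trace (M - B) = 0"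
    using majorants_trace_diff[OF M] by linarith+
  moreover have "nonneg_definite (M - A)" "nonneg_definite (M - B)"
    "transpose (M - A) = M - A" "transpose (M - B) = M - B"
    using M assms(1,2) by (simp_all add: majorants_def loewner_ge_def nnd_cone_iff transpose_diff)
  ultimately have "M - A = 0" "M - B = 0"
    by (simp_all only: nonneg_definite_trace_0_imp_0)
  then show ?thesis by simp
qed

lemma delta_triangle:
  assumes "A \<in> nnd_cone" "B \<in> nnd_cone" "C \<in> nnd_cone"
  shows "delta A C \<le> delta A B + delta B C"
proof -
  obtain M where M: "M \<in> majorants A B"
    and AB: "delta A B = (trace (M - A) + trace (M - B)) / real CARD('a)"
    using delta_attained[OF assms(1,2)] by blast
  obtain N where N: "N \<in> majorants B C"
    and BC: "delta B C = (trace (N - B) + trace (N - C)) / real CARD('a)"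
    using delta_attained[OF assms(2,3)] by blast
  have "delta A C \<le> (trace (M + N - B - A) + trace (M + N - B - C)) / real CARD('a)"
    using delta_attained[OF assms(1,3)] majorants_compose[OF M N assms(1,2)] by metis
  \<comment> \<open>The doubled \<open>B\<close> gives one copy to each of the two
    distances.\<close>
  also have "\<dots> = delta A B + delta B C"
    by (simp add: AB BC trace_sub trace_add field_simps)
  finally show ?thesis .
qed

theorem proposition1:
  shows "(\<forall>M\<^sub>1 \<in> (nnd_cone :: (real^'n^'n) set). \<forall>M\<^sub>2 \<in> nnd_cone.
            \<exists>t \<in> majorant_traces M\<^sub>1 M\<^sub>2. \<forall>s \<in> majorant_traces M\<^sub>1 M\<^sub>2. t \<le> s)
       \<and> Metric_space (nnd_cone :: (real^'n^'n) set) delta_on_cone"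
proof (intro conjI ballI)
  fix A B :: "real^'n^'n"
  assume "A \<in> nnd_cone" "B \<in> nnd_cone"
  then obtain M where "M \<in> majorants A B" "\<And>N. N \<in> majorants A B \<Longrightarrow> trace M \<le> trace N"
    using majorants_min_trace by blast
  then show "\<exists>t \<in> majorant_traces A B. \<forall>s \<in> majorant_traces A B. t \<le> s"
    unfolding majorant_traces_eq by (auto intro!: bexI[of _ M] divide_right_mono)
next
  show "Metric_space (nnd_cone :: (real^'n^'n) set) delta_on_cone"
    \<comment> \<open>Nonnegativity and symmetry are required of all matrices, and the default value
      0 settles them off the cone; the other two axioms concern the cone only.\<close>
    by unfold_locales
      (auto simp: delta_on_cone_def delta_nonneg delta_commute delta_self delta_triangle
        intro: delta_0_imp_eq)
qed

end
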